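(* Let $G$ be a $d$-regular graph and let $\mathrm{Ev}_\ell$ denote the number of totally even closed non-backtracking walks of length $\ell$ in $G$. Then $\mathrm{Ev}_\ell=\mathbb E_\sigma\operatorname{tr}(B_\sigma^\ell)$, the average over all signings $\sigma\in\{\pm1\}^E$. Moreover, for even $\ell$, the doubling map $w\mapsto w^2$ injects closed non-backtracking walks of length $\ell/2$ into totally even closed non-backtracking walks of length $\ell$, so $$\mathrm{Ev}_\ell\ge\operatorname{tr}(B^{\ell/2})$$ and $$\liminf_{\ell\to\infty,\ \ell\text{ even}}\mathrm{Ev}_\ell^{1/\ell}\ge\rho(B)^{1/2}=\sqrt{d-1}.$$
   Context: $G=(V,E)$ is a finite simple connected graph. The signed non-backtracking operator $B_\sigma$ acts on the $2|E|$ directed edges: $(B_\sigma)_{e,f}=\sigma_f$ if the head of $e$ is the tail of $f$ and $f\ne\bar e$ ($\bar e$ the reversal of $e$; a directed edge carries the sign of its underlying edge), and $0$ otherwise; $B$ is the case $\sigma\equiv1$, and $\rho(B)$ is its spectral radius. A closed non-backtracking walk of length $\ell$ is a sequence of directed edges $(e_1,\dots,e_\ell)$ with head of $e_i$ equal to tail of $e_{i+1}$ and $e_{i+1}\ne\bar e_i$ for all $i$ modulo $\ell$ (the starting directed edge is marked); $w^2$ is $w$ traversed twice. It is totally even if every (undirected) edge is traversed an even number of times.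
   Formalization: The liminf bound is stated for d ≥ 1, d ≠ 2: for d = 2, G is a cycle C_n and Ev_ℓ = 0 for infinitely many even ℓ, so the bound fails. The equality ρ(B)^{1/2} = √(d−1) assumes d ≥ 1, since √(−1) is undefined for d = 0. Walk lengths ℓ are positive. *)

theory Defs
  imports "Graph_Theory.Graph_Theory" "Jordan_Normal_Form.Spectral_Radius"
begin

(* A finite simple graph is a pair_graph: a finite vertex set pverts G together with a
   symmetric irreflexive arc set parcs G.  The arcs are exactly the directed edges, (u, v)
   having tail u and head v, and the reversal of e is prod.swap e. *)

definition uedge :: "'a \<times> 'a \<Rightarrow> 'a set" where
  "uedge e = {fst e, snd e}"

definition uedges :: "'a pair_pre_digraph \<Rightarrow> 'a set set" where
  "uedges G = uedge ` parcs G"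

definition regular_graph :: "'a pair_pre_digraph \<Rightarrow> nat \<Rightarrow> bool" where
  "regular_graph G d \<longleftrightarrow> (\<forall>v \<in> pverts G. out_degree (with_proj G) v = d)"

definition signings :: "'a pair_pre_digraph \<Rightarrow> ('a set \<Rightarrow> real) set" where
  "signings G = uedges G \<rightarrow>\<^sub>E {-1, 1}"

(* The signed non-backtracking matrix; rows and columns are indexed by positions in a list
   es that enumerates the directed edges without repetition. *)
definition nb_matrix :: "('a \<times> 'a) list \<Rightarrow> ('a set \<Rightarrow> real) \<Rightarrow> real mat" where
  "nb_matrix es \<sigma> = mat (length es) (length es) (\<lambda>(i, j).
     if snd (es ! i) = fst (es ! j) \<and> es ! j \<noteq> prod.swap (es ! i) then \<sigma> (uedge (es ! j)) else 0)"

definition mat_trace :: "'b::comm_monoid_add mat \<Rightarrow> 'b" where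
  "mat_trace A = (\<Sum>i<dim_row A. A $$ (i, i))"

definition closed_nb_walks :: "'a pair_pre_digraph \<Rightarrow> nat \<Rightarrow> ('a \<times> 'a) list set" where
  "closed_nb_walks G l = {w. length w = l \<and> set w \<subseteq> parcs G \<and>
     (\<forall>i<l. snd (w ! i) = fst (w ! (Suc i mod l)) \<and> w ! (Suc i mod l) \<noteq> prod.swap (w ! i))}"

definition totally_even :: "'a pair_pre_digraph \<Rightarrow> ('a \<times> 'a) list \<Rightarrow> bool" where
  "totally_even G w \<longleftrightarrow> (\<forall>x \<in> uedges G. even (count_list (map uedge w) x))"

definition even_walks :: "'a pair_pre_digraph \<Rightarrow> nat \<Rightarrow> ('a \<times> 'a) list set" where
  "even_walks G l = {w \<in> closed_nb_walks G l. totally_even G w}"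

definition Ev :: "'a pair_pre_digraph \<Rightarrow> nat \<Rightarrow> nat" where
  "Ev G l = card (even_walks G l)"

end

(* A signing averages out every closed walk that crosses some edge an odd number of times.
   The spectral radius is d - 1 because all row sums of B are d - 1.

   In a bipartite graph tr (B^k) vanishes for odd k, so doubling alone gives no lower bound on
   Ev_l for l = 2 mod 4.  For d >= 3 we use instead walks e w (rev e) w', where w and w' are "even
   turnarounds": closed totally even walks after which an arc can be followed by its reversal.
   A turnaround of half-length s after f yields one of half-length s + 1 before any predecessor
   of f, so the number of turnarounds grows by the factor d - 1 once every arc has one of the same
   half-length m.  Such an m exists: let X_s be the set of arcs with a turnaround of half-length s.
   As every arc has d - 1 successors and d - 1 predecessors, |X_s| is nondecreasing, and
   once it is constant X_s consists of all arcs leaving a vertex set V_s with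
   V_{s+1} = N(V_s) and V_{s+2} = V_s.  Concatenating two turnarounds after different successors
   turns half-lengths s, s into 2s + 2, which forces V_s and V_{s+1} to meet for even s; by
   connectivity both are then the whole vertex set. *)
theory Submission
  imports Defs
begin


section \<open>Non-backtracking steps and closed walks\<close>

definition nb_step :: "'a \<times> 'a \<Rightarrow> 'a \<times> 'a \<Rightarrow> bool" where
  "nb_step e f \<longleftrightarrow> snd e = fst f \<and> f \<noteq> prod.swap e"

lemma nb_step_swap: "nb_step (prod.swap f) (prod.swap e) \<longleftrightarrow> nb_step e f"
  by (cases e; cases f) (auto simp: nb_step_def)

lemma uedge_swap [simp]: "uedge (prod.swap e) = uedge e"
  by (auto simp: uedge_def)

text \<open>Only the last index wraps around modulo \<open>l\<close>, so the cyclic condition splits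
  into a linear one and one closing step. For \<open>l = 0\<close> that step would refer to
  \<open>last []\<close> and \<open>hd []\<close>.\<close>

lemma closed_nb_walks_iff:
  assumes "l > 0"
  shows "w \<in> closed_nb_walks G l \<longleftrightarrow>
    length w = l \<and> set w \<subseteq> parcs G \<and> successively nb_step w \<and> nb_step (last w) (hd w)"
proof -
  obtain m where m: "l = Suc m"
    using assms by (cases l) auto
  have "(\<forall>i<l. nb_step (w ! i) (w ! (Suc i mod l))) \<longleftrightarrow>
      successively nb_step w \<and> nb_step (last w) (hd w)" if len: "length w = l"
  proof -
    have "w \<noteq> []"
      using len m by auto
    then have "last w = w ! m" "hd w = w ! 0"
      using len m by (simp_all add: last_conv_nth hd_conv_nth)
    moreover have "successively nb_step w \<longleftrightarrow> (\<forall>i<m. nb_step (w ! i) (w ! Suc i))"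
      using len m by (simp add: successively_conv_nth)
    moreover have "(\<forall>i<m. nb_step (w ! i) (w ! (Suc i mod Suc m))) \<longleftrightarrow>
        (\<forall>i<m. nb_step (w ! i) (w ! Suc i))"
      by simp
    ultimately show ?thesis
      unfolding m All_less_Suc by auto
  qed
  then show ?thesis
    by (auto simp: closed_nb_walks_def nb_step_def)
qed

lemma finite_closed_nb_walks:
  assumes "finite (parcs G)"
  shows "finite (closed_nb_walks G l)"
  by (rule finite_subset[OF _ finite_lists_length_eq[OF assms, of l]])
    (auto simp: closed_nb_walks_def)

section \<open>Traces of powers count closed walks\<close>

text \<open>The starting arc \<open>e\<close> is left out of the list and the final arc is kept, as
  a matrix entry carries the sign of its column. A closed walk is thus a path from its own last arc
  to itself.\<close>

definition nb_paths :: "('a \<times> 'a) set \<Rightarrow> 'a \<times> 'a \<Rightarrow> nat \<Rightarrow> 'a \<times> 'a \<Rightarrow> ('a \<times> 'a) list set" where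
  "nb_paths E e k f =
    {w. length w = k \<and> set w \<subseteq> E \<and> successively nb_step (e # w) \<and> last (e # w) = f}"

definition weight :: "('a set \<Rightarrow> real) \<Rightarrow> ('a \<times> 'a) list \<Rightarrow> real" where
  "weight \<sigma> w = (\<Prod>e\<leftarrow>w. \<sigma> (uedge e))"

lemma finite_nb_paths:
  assumes "finite E"
  shows "finite (nb_paths E e k f)"
  by (rule finite_subset[OF _ finite_lists_length_eq[OF assms, of k]]) (auto simp: nb_paths_def)

lemma nb_paths_Suc:
  assumes "e \<in> E" "f \<in> E"
  shows "nb_paths E e (Suc k) f =
    (\<Union>g\<in>{g \<in> E. nb_step g f}. (\<lambda>w. w @ [f]) ` nb_paths E e k g)" (is "?L = ?R")
proof (intro equalityI subsetI)
  fix w assume "w \<in> ?L"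
  then have w: "length w = Suc k" "set w \<subseteq> E" "successively nb_step (e # w)" "last (e # w) = f"
    by (auto simp: nb_paths_def)
  obtain u x where u: "w = u @ [x]"
    using w(1) by (cases w rule: rev_cases) auto
  have x: "x = f"
    using w(4) u by simp
  have succ: "successively nb_step ((e # u) @ [f])"
    using w(3) u x by simp
  have "nb_step (last (e # u)) f" "successively nb_step (e # u)"
    using succ unfolding successively_append_iff by auto
  \<comment> \<open>For \<open>u = []\<close> this is \<open>e\<close> itself, hence the assumption
    \<open>e \<in> E\<close>.\<close>
  moreover have "last (e # u) \<in> E"
    using w(2) u assms by (metis Un_subset_iff last_ConsL last_ConsR last_in_set set_append subsetD)
  ultimately show "w \<in> ?R"
    using w u x unfolding nb_paths_def
    by (intro UN_I[of "last (e # u)"]) auto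
next
  fix w assume "w \<in> ?R"
  then obtain g u where u: "w = u @ [f]" "nb_step g f" "u \<in> nb_paths E e k g"
    by auto
  have "successively nb_step ((e # u) @ [f])"
    using u unfolding successively_append_iff nb_paths_def by auto
  then show "w \<in> ?L"
    using u assms by (auto simp: nb_paths_def)
qed

lemma sum_nth_distinct:
  assumes "distinct es"
  shows "(\<Sum>i<length es. h (es ! i)) = sum h (set es)"
  by (rule sum.reindex_bij_betw) (use assms bij_betw_nth in blast)

lemma nb_matrix_carrier: "nb_matrix es \<sigma> \<in> carrier_mat (length es) (length es)"
  by (simp add: nb_matrix_def)

lemma nb_matrix_entry:
  "i < length es \<Longrightarrow> j < length es \<Longrightarrow>
    nb_matrix es \<sigma> $$ (i, j) = (if nb_step (es ! i) (es ! j) then \<sigma> (uedge (es ! j)) else 0)"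
  by (simp add: nb_matrix_def nb_step_def)

text \<open>Multiplying by one more factor on the right appends one arc, so the induction peels off
  the last arc of a path.\<close>

lemma nb_matrix_pow:
  assumes "distinct es" "i < length es" "j < length es"
  shows "(nb_matrix es \<sigma> ^\<^sub>m k) $$ (i, j) = (\<Sum>w\<in>nb_paths (set es) (es ! i) k (es ! j). weight \<sigma> w)"
  using assms(3)
proof (induction k arbitrary: j)
  case 0
  have "nb_paths (set es) (es ! i) 0 (es ! j) = (if i = j then {[]} else {})"
    using assms 0 by (auto simp: nb_paths_def nth_eq_iff_index_eq)
  then show ?case
    using assms 0 by (simp add: weight_def one_mat_def nb_matrix_def)
next
  case (Suc k)
  let ?n = "length es" and ?A = "nb_matrix es \<sigma>" and ?E = "set es"
  let ?P = "nb_paths ?E (es ! i) k" and ?f = "es ! j"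
  have car: "?A ^\<^sub>m k \<in> carrier_mat ?n ?n"
    by (rule pow_carrier_mat[OF nb_matrix_carrier])
  have "(?A ^\<^sub>m Suc k) $$ (i, j) = (\<Sum>m<?n. (?A ^\<^sub>m k) $$ (i, m) * ?A $$ (m, j))"
    using car nb_matrix_carrier[of es \<sigma>] Suc.prems assms
    by (simp add: times_mat_def scalar_prod_def atLeast0LessThan)
  also have "\<dots> = (\<Sum>m<?n. (\<Sum>w\<in>?P (es ! m). weight \<sigma> w) *
      (if nb_step (es ! m) ?f then \<sigma> (uedge ?f) else 0))"
    by (rule sum.cong) (use Suc in \<open>auto simp: nb_matrix_entry\<close>)
  also have "\<dots> = (\<Sum>g\<in>?E. (\<Sum>w\<in>?P g. weight \<sigma> w) * (if nb_step g ?f then \<sigma> (uedge ?f) else 0))"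
    by (rule sum_nth_distinct[OF assms(1)])
  also have "\<dots> = (\<Sum>g\<in>{g \<in> ?E. nb_step g ?f}. (\<Sum>w\<in>?P g. weight \<sigma> w) * \<sigma> (uedge ?f))"
    by (rule sum.mono_neutral_cong_right) auto
  also have "\<dots> = (\<Sum>g\<in>{g \<in> ?E. nb_step g ?f}. \<Sum>w\<in>(\<lambda>w. w @ [?f]) ` ?P g. weight \<sigma> w)"
    by (rule sum.cong)
      (auto simp: sum.reindex inj_on_def weight_def sum_distrib_right)
  \<comment> \<open>The union is disjoint because the arc before the final one determines
    \<open>g\<close>.\<close>
  also have "\<dots> = (\<Sum>w\<in>(\<Union>g\<in>{g \<in> ?E. nb_step g ?f}. (\<lambda>w. w @ [?f]) ` ?P g). weight \<sigma> w)"
    by (rule sum.UNION_disjoint[symmetric]) (simp_all add: finite_nb_paths, auto simp: nb_paths_def)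
  also have "\<dots> = (\<Sum>w\<in>nb_paths ?E (es ! i) (Suc k) ?f. weight \<sigma> w)"
    using assms Suc.prems by (simp add: nb_paths_Suc)
  finally show ?case .
qed

text \<open>A closed walk \<open>w\<close> is counted exactly once, at the diagonal position of
  \<open>last w\<close>. For \<open>l = 0\<close> the trace would count all arcs, whereas there is a
  single empty walk.\<close>

lemma trace_nb_matrix_pow:
  fixes G :: "'a pair_pre_digraph"
  assumes "distinct es" "set es = parcs G" "l > 0"
  shows "mat_trace (nb_matrix es \<sigma> ^\<^sub>m l) = (\<Sum>w\<in>closed_nb_walks G l. weight \<sigma> w)"
proof -
  have iff: "successively nb_step (last w # w) \<longleftrightarrow> successively nb_step w \<and> nb_step (last w) (hd w)"
    if "w \<noteq> []" for w
    using that by (auto simp: successively_Cons)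
  have "closed_nb_walks G l = (\<Union>e\<in>set es. nb_paths (set es) e l e)"
  proof (intro equalityI subsetI)
    fix w assume w: "w \<in> closed_nb_walks G l"
    then have "w \<noteq> []"
      using assms by (auto simp: closed_nb_walks_iff)
    then show "w \<in> (\<Union>e\<in>set es. nb_paths (set es) e l e)"
      using w iff assms by (intro UN_I[of "last w"]) (auto simp: closed_nb_walks_iff nb_paths_def)
  next
    fix w assume "w \<in> (\<Union>e\<in>set es. nb_paths (set es) e l e)"
    then obtain e where w: "w \<in> nb_paths (set es) e l e"
      by blast
    then have "w \<noteq> []"
      using assms by (auto simp: nb_paths_def)
    then show "w \<in> closed_nb_walks G l"
      using w iff assms by (auto simp: closed_nb_walks_iff nb_paths_def)
  qed
  then have "(\<Sum>w\<in>closed_nb_walks G l. weight \<sigma> w) =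
      (\<Sum>w\<in>(\<Union>e\<in>set es. nb_paths (set es) e l e). weight \<sigma> w)"
    by (rule arg_cong)
  also have "\<dots> = (\<Sum>e\<in>set es. \<Sum>w\<in>nb_paths (set es) e l e. weight \<sigma> w)"
    by (rule sum.UNION_disjoint) (simp_all add: finite_nb_paths, use assms(3) in \<open>auto simp: nb_paths_def\<close>)
  also have "\<dots> = (\<Sum>i<length es. \<Sum>w\<in>nb_paths (set es) (es ! i) l (es ! i). weight \<sigma> w)"
    by (rule sum_nth_distinct[OF assms(1), symmetric])
  also have "\<dots> = mat_trace (nb_matrix es \<sigma> ^\<^sub>m l)"
    unfolding mat_trace_def
    by (rule sum.cong) (use nb_matrix_carrier[of es \<sigma>] assms(1) in \<open>simp_all add: nb_matrix_pow\<close>)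
  finally show ?thesis
    by (rule sym)
qed

section \<open>Averaging over signings\<close>

lemma weight_eq_prod_count:
  assumes "finite U" "uedge ` set w \<subseteq> U"
  shows "weight \<sigma> w = (\<Prod>x\<in>U. \<sigma> x ^ count_list (map uedge w) x)"
  using assms(2)
proof (induction w)
  case Nil
  then show ?case by (simp add: weight_def)
next
  case (Cons e w)
  have "(\<Prod>x\<in>U. \<sigma> x ^ count_list (map uedge (e # w)) x) =
      (\<Prod>x\<in>U. (if x = uedge e then \<sigma> x else 1) * \<sigma> x ^ count_list (map uedge w) x)"
    by (rule prod.cong) auto
  also have "\<dots> = \<sigma> (uedge e) * (\<Prod>x\<in>U. \<sigma> x ^ count_list (map uedge w) x)"
    using assms(1) Cons.prems by (simp add: prod.distrib)
  finally show ?case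
    using Cons by (simp add: weight_def)
qed

text \<open>With the weight grouped by undirected edges, the sum over signings factors into one sum
  per edge, \<open>(-1) ^ c + 1 ^ c\<close>, which is 2 or 0 according to the parity of the count
  \<open>c\<close>.\<close>

lemma sum_weight_signings:
  assumes "finite (parcs G)" "set w \<subseteq> parcs G"
  shows "(\<Sum>\<sigma>\<in>signings G. weight \<sigma> w) = (if totally_even G w then real (card (signings G)) else 0)"
proof -
  have fin: "finite (uedges G)"
    using assms by (simp add: uedges_def)
  let ?c = "count_list (map uedge w)"
  have "(\<Sum>\<sigma>\<in>signings G. weight \<sigma> w) = (\<Sum>\<sigma>\<in>signings G. \<Prod>x\<in>uedges G. \<sigma> x ^ ?c x)"
    using assms(2) by (intro sum.cong weight_eq_prod_count fin) (auto simp: uedges_def)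
  also have "\<dots> = (\<Prod>x\<in>uedges G. \<Sum>s\<in>{-1, 1::real}. s ^ ?c x)"
    unfolding signings_def by (rule prod_sum_PiE[symmetric]) (use fin in auto)
  also have "\<dots> = (\<Prod>x\<in>uedges G. if even (?c x) then 2 else 0)"
    by (rule prod.cong) auto
  also have "\<dots> = (if totally_even G w then 2 ^ card (uedges G) else 0)"
    using fin by (auto simp: totally_even_def)
  also have "(2::real) ^ card (uedges G) = real (card (signings G))"
    using fin by (simp add: signings_def card_PiE)
  finally show ?thesis .
qed

lemma Ev_eq_average:
  assumes "finite (parcs G)" "distinct es" "set es = parcs G" "l > 0"
  shows "real (Ev G l) =
    (\<Sum>\<sigma>\<in>signings G. mat_trace (nb_matrix es \<sigma> ^\<^sub>m l)) / real (card (signings G))"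
proof -
  let ?N = "real (card (signings G))"
  have "finite (uedges G)"
    using assms by (simp add: uedges_def)
  then have N: "?N \<noteq> 0"
    by (simp add: signings_def card_PiE)
  have "(\<Sum>\<sigma>\<in>signings G. mat_trace (nb_matrix es \<sigma> ^\<^sub>m l)) =
      (\<Sum>w\<in>closed_nb_walks G l. \<Sum>\<sigma>\<in>signings G. weight \<sigma> w)"
    by (simp add: trace_nb_matrix_pow[OF assms(2-4)] sum.swap[of _ "signings G"])
  also have "\<dots> = (\<Sum>w\<in>closed_nb_walks G l. if totally_even G w then ?N else 0)"
    by (rule sum.cong[OF refl], rule sum_weight_signings[OF assms(1)])
      (simp add: closed_nb_walks_def)
  also have "\<dots> = (\<Sum>w\<in>even_walks G l. ?N)"
    by (rule sum.mono_neutral_cong_right)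
      (use assms(1) in \<open>auto simp: even_walks_def finite_closed_nb_walks\<close>)
  also have "\<dots> = real (Ev G l) * ?N"
    by (simp add: Ev_def)
  finally show ?thesis
    using N by simp
qed

section \<open>The doubling map\<close>

lemma append_self_even_walk:
  assumes "w \<in> closed_nb_walks G k" "k > 0"
  shows "w @ w \<in> even_walks G (2 * k)"
proof -
  have w: "length w = k" "set w \<subseteq> parcs G" "successively nb_step w" "nb_step (last w) (hd w)"
    using assms by (simp_all add: closed_nb_walks_iff)
  then have "w \<noteq> []"
    using assms by auto
  \<comment> \<open>The junction in the middle is the closing step of \<open>w\<close>.\<close>
  then have "successively nb_step (w @ w)" "nb_step (last (w @ w)) (hd (w @ w))"
    using w by (simp_all add: successively_append_iff)
  then have "w @ w \<in> closed_nb_walks G (2 * k)"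
    using w assms by (subst closed_nb_walks_iff) simp_all
  then show ?thesis
    by (simp add: even_walks_def totally_even_def)
qed

lemma card_closed_le_Ev:
  assumes "finite (parcs G)" "k > 0"
  shows "card (closed_nb_walks G k) \<le> Ev G (2 * k)"
  unfolding Ev_def
proof (rule card_inj_on_le)
  show "inj_on (\<lambda>w. w @ w) (closed_nb_walks G k)"
    by (auto simp: inj_on_def closed_nb_walks_def)
  show "(\<lambda>w. w @ w) ` closed_nb_walks G k \<subseteq> even_walks G (2 * k)"
    using append_self_even_walk assms by blast
  show "finite (even_walks G (2 * k))"
    by (rule finite_subset[OF _ finite_closed_nb_walks[OF assms(1)]]) (auto simp: even_walks_def)
qed

section \<open>The spectral radius\<close>

text \<open>The all-ones vector is an eigenvector for \<open>r\<close>. Conversely, an eigenvalue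
  equation read at a coordinate of maximal modulus bounds the modulus of the eigenvalue by the row
  sum.\<close>

lemma spectral_radius_constant_row_sums:
  fixes B :: "real mat"
  assumes B: "B \<in> carrier_mat n n" and n: "n > 0"
    and nonneg: "\<And>i j. i < n \<Longrightarrow> j < n \<Longrightarrow> 0 \<le> B $$ (i, j)"
    and rows: "\<And>i. i < n \<Longrightarrow> (\<Sum>j<n. B $$ (i, j)) = r"
  shows "spectral_radius (map_mat complex_of_real B) = r"
proof -
  let ?A = "map_mat complex_of_real B"
  have A: "?A \<in> carrier_mat n n"
    using B by simp
  have r: "0 \<le> r"
    using rows[of 0] n nonneg by (metis (no_types, lifting) lessThan_iff sum_nonneg)
  have mult: "(?A *\<^sub>v v) $ i = (\<Sum>j<n. complex_of_real (B $$ (i, j)) * v $ j)"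
    if "i < n" "v \<in> carrier_vec n" for v i
    using that B by (auto simp: scalar_prod_def atLeast0LessThan intro!: sum.cong)
  define one where "one = vec n (\<lambda>_. 1::complex)"
  have one: "one \<in> carrier_vec n" "one \<noteq> 0\<^sub>v n"
    using n by (auto simp: one_def vec_eq_iff)
  have "?A *\<^sub>v one = complex_of_real r \<cdot>\<^sub>v one"
  proof (rule eq_vecI)
    fix i assume "i < dim_vec (complex_of_real r \<cdot>\<^sub>v one)"
    then have i: "i < n"
      by (simp add: one_def)
    have "(?A *\<^sub>v one) $ i = complex_of_real (\<Sum>j<n. B $$ (i, j))"
      unfolding mult[OF i one(1)] by (simp add: one_def)
    then show "(?A *\<^sub>v one) $ i = (complex_of_real r \<cdot>\<^sub>v one) $ i"
      using i rows by (simp add: one_def)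
  qed (use B in \<open>simp add: one_def\<close>)
  then have "complex_of_real r \<in> spectrum ?A"
    using one B unfolding spectrum_def eigenvalue_def eigenvector_def by auto
  then have le: "r \<le> spectral_radius ?A"
    using spectral_radius_mem_max(2)[OF A n, of "cmod (complex_of_real r)"] r by force
  obtain a where a: "eigenvalue ?A a" "spectral_radius ?A = cmod a"
    using spectral_radius_mem_max(1)[OF A n] by (auto simp: spectrum_def)
  then obtain v where v: "v \<in> carrier_vec n" "v \<noteq> 0\<^sub>v n" "?A *\<^sub>v v = a \<cdot>\<^sub>v v"
    using B unfolding eigenvalue_def eigenvector_def by auto
  define m where "m = Max ((\<lambda>i. cmod (v $ i)) ` {..<n})"
  have "m \<in> (\<lambda>i. cmod (v $ i)) ` {..<n}"
    unfolding m_def using n by (intro Max_in) auto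
  then obtain i where i: "i < n" "m = cmod (v $ i)"
    by auto
  have m: "cmod (v $ j) \<le> m" if "j < n" for j
    unfolding m_def using that by (intro Max_ge) auto
  have "\<exists>j<n. v $ j \<noteq> 0"
  proof (rule ccontr)
    assume "\<not> ?thesis"
    then have "v = 0\<^sub>v n"
      using v(1) by (intro eq_vecI) auto
    with v show False by simp
  qed
  then have "m > 0"
    using m by (metis less_le_trans zero_less_norm_iff)
  \<comment> \<open>Row \<open>i\<close> is the one where the eigenvector attains its maximal
    modulus \<open>m\<close>, which cancels at the end.\<close>
  have "cmod a * m = cmod ((?A *\<^sub>v v) $ i)"
    using v i by (simp add: norm_mult)
  also have "\<dots> = cmod (\<Sum>j<n. complex_of_real (B $$ (i, j)) * v $ j)"
    using mult[OF i(1) v(1)] by simp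
  also have "\<dots> \<le> (\<Sum>j<n. B $$ (i, j) * m)"
    using nonneg m i by (intro sum_norm_le) (auto simp: norm_mult mult_left_mono)
  also have "\<dots> = r * m"
    using rows i by (simp flip: sum_distrib_right)
  finally have "cmod a \<le> r"
    using \<open>m > 0\<close> by simp
  with le a show ?thesis by simp
qed


section \<open>Even turnarounds\<close>

text \<open>Unlike \<open>totally_even\<close> this refers to no graph; for lists of arcs of
  \<open>G\<close> the two agree, since sets that are not edges have count zero.\<close>

definition even_list :: "('a \<times> 'a) list \<Rightarrow> bool" where
  "even_list w \<longleftrightarrow> (\<forall>x. even (count_list (map uedge w) x))"

text \<open>Even lists have even length, so \<open>s\<close> records half of it. The arc
  \<open>e\<close> and its reversal are not part of \<open>w\<close>; they only constrain its two
  ends.\<close>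

definition turnarounds :: "'a pair_pre_digraph \<Rightarrow> 'a \<times> 'a \<Rightarrow> nat \<Rightarrow> ('a \<times> 'a) list set" where
  "turnarounds G e s = {w. length w = 2 * s \<and> set w \<subseteq> parcs G \<and> even_list w \<and>
     successively nb_step (e # w @ [prod.swap e])}"

lemma successively_sandwich:
  "u \<noteq> [] \<Longrightarrow> successively P (x # u @ [y]) \<longleftrightarrow> P x (hd u) \<and> successively P u \<and> P (last u) y"
  by (auto simp: successively_Cons successively_append_iff)

lemma turnaround_not_Nil: "w \<in> turnarounds G e s \<Longrightarrow> w \<noteq> []"
  by (auto simp: turnarounds_def nb_step_def)

section \<open>Arc counts and connectivity in regular graphs\<close>

locale regular_pair_graph = pair_graph G for G :: "'a pair_pre_digraph" +
  fixes d :: nat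
  assumes connected: "Digraph_Component.connected (with_proj G)"
    and regular: "regular_graph G d"
begin

lemma swap_in_parcs: "e \<in> parcs G \<Longrightarrow> prod.swap e \<in> parcs G"
  using graph_symmetric[of "fst e" "snd e"] by (cases e) auto

lemma card_arcs_from: "v \<in> pverts G \<Longrightarrow> card {e \<in> parcs G. fst e = v} = d"
  using regular by (simp add: regular_graph_def out_degree_def out_arcs_def)

lemma card_successors:
  assumes "e \<in> parcs G"
  shows "card {f \<in> parcs G. nb_step e f} = d - 1"
proof -
  have "{f \<in> parcs G. nb_step e f} = {f \<in> parcs G. fst f = snd e} - {prod.swap e}"
    by (auto simp: nb_step_def)
  moreover have "prod.swap e \<in> {f \<in> parcs G. fst f = snd e}"
    using swap_in_parcs[OF assms] by simp
  ultimately show ?thesis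
    using card_arcs_from[of "snd e"] arc_snd_in_verts[OF assms] by simp
qed

text \<open>Reversing arcs exchanges predecessors and successors.\<close>

lemma card_predecessors:
  assumes "f \<in> parcs G"
  shows "card {e \<in> parcs G. nb_step e f} = d - 1"
proof -
  have "{e \<in> parcs G. nb_step e f} = prod.swap ` {g \<in> parcs G. nb_step (prod.swap f) g}"
  proof (intro equalityI subsetI)
    fix e assume "e \<in> {e \<in> parcs G. nb_step e f}"
    then show "e \<in> prod.swap ` {g \<in> parcs G. nb_step (prod.swap f) g}"
      by (intro image_eqI[of _ _ "prod.swap e"]) (auto simp: nb_step_swap swap_in_parcs simp del: swap_simp)
  next
    fix e assume "e \<in> prod.swap ` {g \<in> parcs G. nb_step (prod.swap f) g}"
    then obtain g where g: "g \<in> parcs G" "nb_step (prod.swap f) g" "e = prod.swap g"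
      by blast
    then show "e \<in> {e \<in> parcs G. nb_step e f}"
      using nb_step_swap[of f "prod.swap g"] swap_in_parcs by simp
  qed
  then show ?thesis
    using card_successors[OF swap_in_parcs[OF assms]] by (simp add: card_image)
qed

lemma parcs_nonempty:
  assumes "d \<ge> 1"
  shows "parcs G \<noteq> {}"
proof -
  obtain v where "v \<in> pverts G"
    using connected by (auto simp: connected_conv)
  from card_arcs_from[OF this] assms show ?thesis
    by auto
qed

text \<open>The main use of \<open>d \<ge> 3\<close> is this choice of a further arc at a vertex;
  \<open>a\<close> and \<open>b\<close> may coincide.\<close>

lemma ex_arc_avoiding_two:
  assumes "d \<ge> 3" "v \<in> pverts G"
  obtains e where "e \<in> parcs G" "fst e = v" "e \<noteq> a" "e \<noteq> b"
proof -
  have "card {a, b} \<le> 2"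
    by (simp add: card_insert_if)
  then have "\<not> {e \<in> parcs G. fst e = v} \<subseteq> {a, b}"
    using card_mono[of "{a, b}" "{e \<in> parcs G. fst e = v}"] card_arcs_from[OF assms(2)] assms(1)
    by auto
  then show ?thesis
    using that by blast
qed

text \<open>Along a walk from the tail of an arc in \<open>Y\<close>, \<open>tail\<close> puts the
  next arc into \<open>Y\<close> and \<open>swap\<close> moves on to its head. By connectivity every
  arc is reached.\<close>

lemma eq_parcs_if_closed:
  assumes "Y \<subseteq> parcs G" "Y \<noteq> {}"
    and swap: "\<And>e. e \<in> Y \<Longrightarrow> prod.swap e \<in> Y"
    and tail: "\<And>e f. e \<in> Y \<Longrightarrow> f \<in> parcs G \<Longrightarrow> fst f = fst e \<Longrightarrow> f \<in> Y"
  shows "Y = parcs G"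
proof
  obtain e where e: "e \<in> Y"
    using assms by blast
  have strong: "strongly_connected (with_proj G)"
    by (rule symmetric_connected_imp_strongly_connected[OF pair_sym_arcs connected])
  show "parcs G \<subseteq> Y"
  proof
    fix f assume f: "f \<in> parcs G"
    have "fst e \<rightarrow>\<^sup>*\<^bsub>with_proj G\<^esub> fst f"
      using strong arc_fst_in_verts f e assms(1) unfolding strongly_connected_def by auto
    then have "\<exists>y\<in>Y. fst y = fst f"
    proof (induction rule: reachable_induct)
      case base
      then show ?case using e by blast
    next
      case (step u v)
      then have "(u, v) \<in> Y"
        using tail by auto
      then have "(v, u) \<in> Y"
        using swap by fastforce
      then show ?case by force
    qed
    then show "f \<in> Y"
      using tail f by metis
  qed
qed (fact assms(1))

section \<open>Building and counting turnarounds\<close>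

lemma finite_turnarounds: "finite (turnarounds G e s)"
  by (rule finite_subset[OF _ finite_lists_length_eq[OF pair_finite_arcs, of "2 * s"]])
    (auto simp: turnarounds_def)

text \<open>The arc \<open>f\<close> and its reversal add two traversals of one edge, and the step
  back to the reversal of \<open>e\<close> is the step from \<open>e\<close> to \<open>f\<close>
  reversed.\<close>

lemma turnaround_extend:
  assumes "nb_step e f" "f \<in> parcs G" "w \<in> turnarounds G f s"
  shows "f # w @ [prod.swap f] \<in> turnarounds G e (Suc s)"
proof -
  define u where "u = f # w @ [prod.swap f]"
  have "u \<noteq> []" "hd u = f" "last u = prod.swap f" "length u = 2 * Suc s" "set u \<subseteq> parcs G"
    "even_list u" "successively nb_step u"
    using assms swap_in_parcs by (auto simp: u_def turnarounds_def even_list_def)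
  then have "u \<in> turnarounds G e (Suc s)"
    using assms unfolding turnarounds_def by (simp add: successively_sandwich nb_step_swap)
  then show ?thesis
    by (simp add: u_def)
qed

text \<open>Two excursions can be concatenated because \<open>f \<noteq> g\<close> makes the step
  from the reversal of \<open>f\<close> to \<open>g\<close> non-backtracking. Each contributes its
  half-length plus one.\<close>

lemma turnaround_branch:
  assumes "nb_step e f" "nb_step e g" "f \<noteq> g" "f \<in> parcs G" "g \<in> parcs G"
    and "w \<in> turnarounds G f s" "w' \<in> turnarounds G g t"
  shows "(f # w @ [prod.swap f]) @ (g # w' @ [prod.swap g]) \<in> turnarounds G e (s + t + 2)"
proof -
  define u where "u = f # w @ [prod.swap f]"
  define v where "v = g # w' @ [prod.swap g]"
  have u: "u \<noteq> []" "hd u = f" "last u = prod.swap f" "length u = 2 * Suc s" "set u \<subseteq> parcs G"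
    "even_list u" "successively nb_step u"
    using assms swap_in_parcs by (auto simp: u_def turnarounds_def even_list_def)
  have v: "v \<noteq> []" "hd v = g" "last v = prod.swap g" "length v = 2 * Suc t" "set v \<subseteq> parcs G"
    "even_list v" "successively nb_step v"
    using assms swap_in_parcs by (auto simp: v_def turnarounds_def even_list_def)
  have "nb_step (prod.swap f) g"
    using assms by (auto simp: nb_step_def)
  then have "successively nb_step (u @ v)"
    using u v by (simp add: successively_append_iff)
  then have "successively nb_step (e # (u @ v) @ [prod.swap e])"
    using u v assms by (subst successively_sandwich) (simp_all add: nb_step_swap)
  moreover have "even_list (u @ v)"
    using u v by (simp add: even_list_def)
  ultimately have "u @ v \<in> turnarounds G e (s + t + 2)"
    using u v by (simp add: turnarounds_def)
  then show ?thesis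
    by (simp add: u_def v_def)
qed

text \<open>The extended turnaround determines \<open>f\<close> as its first arc, and then
  \<open>w\<close>.\<close>

lemma card_turnarounds_Suc_ge:
  "(\<Sum>f\<in>{f \<in> parcs G. nb_step e f}. card (turnarounds G f s)) \<le> card (turnarounds G e (Suc s))"
proof -
  let ?S = "SIGMA f:{f \<in> parcs G. nb_step e f}. turnarounds G f s"
  have "card ?S \<le> card (turnarounds G e (Suc s))"
  proof (rule card_inj_on_le)
    show "inj_on (\<lambda>(f, w). f # w @ [prod.swap f]) ?S"
      by (auto simp: inj_on_def)
    show "(\<lambda>(f, w). f # w @ [prod.swap f]) ` ?S \<subseteq> turnarounds G e (Suc s)"
      using turnaround_extend by fast
  qed (rule finite_turnarounds)
  then show ?thesis
    by (simp add: card_SigmaI finite_turnarounds pair_finite_arcs)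
qed

lemma card_turnarounds_ge:
  assumes "\<And>f. f \<in> parcs G \<Longrightarrow> turnarounds G f m \<noteq> {}" "e \<in> parcs G"
  shows "(d - 1) ^ j \<le> card (turnarounds G e (m + j))"
  using assms(2)
proof (induction j arbitrary: e)
  case 0
  then show ?case
    using assms(1) finite_turnarounds by (simp add: Suc_le_eq card_gt_0_iff)
next
  case (Suc j)
  have "(d - 1) ^ Suc j = (\<Sum>f\<in>{f \<in> parcs G. nb_step e f}. (d - 1) ^ j)"
    using card_successors[OF Suc.prems] by simp
  also have "\<dots> \<le> (\<Sum>f\<in>{f \<in> parcs G. nb_step e f}. card (turnarounds G f (m + j)))"
    using Suc.IH by (intro sum_mono) auto
  also have "\<dots> \<le> card (turnarounds G e (m + Suc j))"
    using card_turnarounds_Suc_ge[where e = e and s = "m + j"] by simp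
  finally show ?case .
qed

text \<open>The second turnaround reverses the direction again: it leads from the reversal of
  \<open>e\<close> back to \<open>e\<close>, which closes the walk.\<close>

lemma even_walk_from_turnarounds:
  assumes "e \<in> parcs G" "w \<in> turnarounds G e s" "w' \<in> turnarounds G (prod.swap e) t"
  shows "(e # w @ [prod.swap e]) @ w' \<in> even_walks G (2 * (s + t + 1))"
proof -
  define u where "u = e # w @ [prod.swap e]"
  have u: "u \<noteq> []" "hd u = e" "last u = prod.swap e" "length u = 2 * Suc s" "set u \<subseteq> parcs G"
    "even_list u" "successively nb_step u"
    using assms swap_in_parcs by (auto simp: u_def turnarounds_def even_list_def)
  have w': "w' \<noteq> []" "length w' = 2 * t" "set w' \<subseteq> parcs G" "even_list w'"
    "nb_step (prod.swap e) (hd w')" "successively nb_step w'" "nb_step (last w') e"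
    using assms(3) turnaround_not_Nil[OF assms(3)]
    by (simp_all add: turnarounds_def successively_sandwich)
  have "u @ w' \<in> closed_nb_walks G (2 * (s + t + 1))"
    using u w' by (subst closed_nb_walks_iff) (simp_all add: successively_append_iff)
  moreover have "totally_even G (u @ w')"
    using u w' by (simp add: totally_even_def even_list_def)
  ultimately show ?thesis
    by (simp add: even_walks_def u_def)
qed

text \<open>Following a chosen successor repeatedly must revisit an arc; the segment between two
  visits is closed.\<close>

lemma ex_closed_nb_walk:
  assumes "d \<ge> 2"
  obtains c k where "k > 0" "c \<in> closed_nb_walks G k"
proof -
  have "\<exists>f. f \<in> parcs G \<and> nb_step e f" if "e \<in> parcs G" for e
  proof -
    have "card {f \<in> parcs G. nb_step e f} \<noteq> 0"
      using card_successors[OF that] assms by simp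
    then show ?thesis
      by (metis (no_types, lifting) Collect_empty_eq card.empty)
  qed
  then obtain nxt where nxt: "\<And>e. e \<in> parcs G \<Longrightarrow> nxt e \<in> parcs G \<and> nb_step e (nxt e)"
    by metis
  obtain e where e: "e \<in> parcs G"
    using parcs_nonempty assms by auto
  define a where "a n = (nxt ^^ n) e" for n
  have a: "a n \<in> parcs G" for n
    by (induction n) (use e nxt in \<open>auto simp: a_def\<close>)
  have step: "nb_step (a n) (a (Suc n))" for n
    using nxt[OF a[of n]] by (simp add: a_def)
  have "\<not> inj a"
    using a pair_finite_arcs by (metis finite_imageD finite_subset image_subsetI infinite_UNIV_nat)
  then obtain i j where ij: "i < j" "a i = a j"
    unfolding inj_def by (metis nat_neq_iff)
  define c where "c = map a [i..<j]"
  have "c \<noteq> []"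
    using ij by (simp add: c_def)
  have "last c = a (j - 1)" "hd c = a i"
    using ij by (simp_all add: c_def last_map hd_map)
  then have "nb_step (last c) (hd c)"
    using step[of "j - 1"] ij by simp
  moreover have "successively nb_step c"
    using step by (simp add: c_def successively_conv_nth)
  moreover have "set c \<subseteq> parcs G" "length c = j - i"
    using a by (auto simp: c_def)
  ultimately have "c \<in> closed_nb_walks G (j - i)"
    using ij by (simp add: closed_nb_walks_iff)
  then show ?thesis
    using that[of "j - i" c] ij by simp
qed

section \<open>The sets X_s of the outline, here \<open>turning s\<close>, and their
  stabilization\<close>

definition turning :: "nat \<Rightarrow> ('a \<times> 'a) set" where
  "turning s = {e \<in> parcs G. turnarounds G e s \<noteq> {}}"

lemma ex_turning_nonempty:
  assumes "d \<ge> 3"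
  obtains s where "turning s \<noteq> {}"
proof -
  obtain c k where k: "k > 0" and c: "c \<in> closed_nb_walks G k"
    using ex_closed_nb_walk assms by (metis Suc_leD numeral_2_eq_2 numeral_3_eq_3)
  have c': "length c = k" "set c \<subseteq> parcs G" "successively nb_step c" "nb_step (last c) (hd c)"
    using c k by (auto simp: closed_nb_walks_iff)
  have ne: "c \<noteq> []"
    using c' k by auto
  have "hd c \<in> parcs G"
    using ne c' by auto
  \<comment> \<open>An arc leaving the base vertex of \<open>c\<close>, different from the first arc
    and from the reversed last arc; entering along its reversal, one can run through
    \<open>c\<close> twice and leave by \<open>f\<close>.\<close>
  then obtain f where f: "f \<in> parcs G" "fst f = fst (hd c)" "f \<noteq> hd c" "f \<noteq> prod.swap (last c)"
    using ex_arc_avoiding_two[OF assms arc_fst_in_verts] by metis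
  define e where "e = prod.swap f"
  have "nb_step e (hd c)" "nb_step (last c) (prod.swap e)"
    using f c'(4) by (auto simp: e_def nb_step_def)
  moreover have "successively nb_step (c @ c)"
    using c' ne by (simp add: successively_append_iff)
  ultimately have "c @ c \<in> turnarounds G e k"
    using c' ne unfolding turnarounds_def by (simp add: successively_sandwich[of "c @ c", simplified] even_list_def)
  then have "e \<in> turning k"
    using f swap_in_parcs by (auto simp: turning_def e_def)
  then show ?thesis
    using that by blast
qed

lemma predecessor_turning:
  "f \<in> turning s \<Longrightarrow> e \<in> parcs G \<Longrightarrow> nb_step e f \<Longrightarrow> e \<in> turning (Suc s)"
  using turnaround_extend unfolding turning_def by fastforce

text \<open>Double counting of steps into \<open>X\<close>: each arc of \<open>X\<close> has
  \<open>d - 1\<close> predecessors, all in \<open>P\<close>, and each arc of \<open>P\<close> has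
  \<open>d - 1\<close> successors. In the equality case no step from \<open>P\<close> leaves
  \<open>X\<close>.\<close>

lemma predecessors_expand:
  assumes "d \<ge> 2" "X \<subseteq> parcs G"
  defines "P \<equiv> {e \<in> parcs G. \<exists>f\<in>X. nb_step e f}"
  shows "card X \<le> card P"
    and "card P \<le> card X \<Longrightarrow> e \<in> P \<Longrightarrow> f \<in> parcs G \<Longrightarrow> nb_step e f \<Longrightarrow> f \<in> X"
proof -
  let ?R = "{(e, f). e \<in> parcs G \<and> f \<in> X \<and> nb_step e f}"
  let ?R' = "{(e, f). e \<in> P \<and> f \<in> parcs G \<and> nb_step e f}"
  have fin: "finite X" "finite P"
    using assms finite_subset[OF _ pair_finite_arcs] by (auto simp: P_def)
  have "?R = prod.swap ` (SIGMA f:X. {e \<in> parcs G. nb_step e f})"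
    by auto
  then have "card ?R = card (SIGMA f:X. {e \<in> parcs G. nb_step e f})"
    by (simp add: card_image)
  also have "\<dots> = card X * (d - 1)"
    using fin assms(2) card_predecessors
    by (subst card_SigmaI) (auto simp: pair_finite_arcs subset_eq)
  finally have R: "card ?R = card X * (d - 1)" .
  have R'_eq: "?R' = (SIGMA e:P. {f \<in> parcs G. nb_step e f})"
    by auto
  have finR': "finite ?R'"
    unfolding R'_eq using fin pair_finite_arcs by auto
  have R': "card ?R' = card P * (d - 1)"
    unfolding R'_eq using fin card_successors by (simp add: card_SigmaI pair_finite_arcs P_def)
  have sub: "?R \<subseteq> ?R'"
    using assms(2) by (auto simp: P_def)
  have "card X * (d - 1) \<le> card P * (d - 1)"
    using card_mono[OF finR' sub] R R' by simp
  then show "card X \<le> card P"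
    using assms(1) by simp
  show "f \<in> X" if "card P \<le> card X" "e \<in> P" "f \<in> parcs G" "nb_step e f"
  proof -
    have "card ?R' \<le> card ?R"
      unfolding R R' using that(1) by simp
    then have "?R = ?R'"
      by (rule card_seteq[OF finR' sub])
    moreover have "(e, f) \<in> ?R'"
      using that by simp
    ultimately show ?thesis
      by blast
  qed
qed

lemma turning_stabilizes:
  assumes "d \<ge> 3"
  obtains s0 where "\<And>s. s \<ge> s0 \<Longrightarrow> turning s \<noteq> {}"
    and "\<And>s e f. s \<ge> s0 \<Longrightarrow> e \<in> turning (Suc s) \<Longrightarrow> f \<in> parcs G \<Longrightarrow> nb_step e f \<Longrightarrow> f \<in> turning s"
proof -
  let ?P = "\<lambda>s. {e \<in> parcs G. \<exists>f\<in>turning s. nb_step e f}"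
  have sub: "turning s \<subseteq> parcs G" for s
    by (auto simp: turning_def)
  have fin: "finite (turning s)" for s
    by (rule finite_subset[OF sub pair_finite_arcs])
  have P_sub: "?P s \<subseteq> turning (Suc s)" for s
    using predecessor_turning by blast
  have d2: "d \<ge> 2"
    using assms by simp
  have card_P: "card (turning s) \<le> card (?P s)" for s
    by (rule predecessors_expand(1)[OF d2 sub])
  have "card (turning s) \<le> card (turning (Suc s))" for s
    using card_P[of s] card_mono[OF fin P_sub, of s] by linarith
  then have mono: "s \<le> t \<Longrightarrow> card (turning s) \<le> card (turning t)" for s t
    by (rule lift_Suc_mono_le)
  have fin_range: "finite (range (\<lambda>s. card (turning s)))"
    by (rule finite_subset[of _ "{..card (parcs G)}"])
      (auto intro: card_mono[OF pair_finite_arcs sub])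
  \<comment> \<open>The cardinalities are bounded and nondecreasing, so they are constant from an
    index where the maximum is attained.\<close>
  obtain s0 where s0: "card (turning s0) = Max (range (\<lambda>s. card (turning s)))"
    using Max_in[OF fin_range] by fastforce
  have const: "card (turning s) = card (turning s0)" if "s \<ge> s0" for s
    using mono[OF that] Max_ge[OF fin_range, of "card (turning s)"] s0 by simp
  show ?thesis
  proof
    obtain t where "turning t \<noteq> {}"
      using ex_turning_nonempty[OF assms] by blast
    then have "0 < card (turning t)"
      using fin by (simp add: card_gt_0_iff)
    also have "\<dots> \<le> card (turning s0)"
      using Max_ge[OF fin_range, of "card (turning t)"] s0 by simp
    finally show "turning s \<noteq> {}" if "s \<ge> s0" for s
      using const[OF that] by auto
    show "f \<in> turning s" if "s \<ge> s0" "e \<in> turning (Suc s)" "f \<in> parcs G" "nb_step e f" for s e f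
    proof -
      have eq: "card (turning (Suc s)) = card (turning s)"
        using const[of s] const[of "Suc s"] that by simp
      \<comment> \<open>The set of predecessors is squeezed between two sets of equal cardinality,
        so the equality case of \<open>predecessors_expand\<close> applies.\<close>
      then have "?P s = turning (Suc s)"
        using card_P[of s] by (intro card_seteq fin P_sub) simp
      then show ?thesis
        using predecessors_expand(2)[OF d2 sub[of s], of e f] eq that by simp
    qed
  qed
qed

lemma ex_all_turning:
  assumes "d \<ge> 3"
  obtains m where "turning m = parcs G"
proof -
  obtain s0 where ne: "\<And>s. s \<ge> s0 \<Longrightarrow> turning s \<noteq> {}"
    and succ: "\<And>s e f. s \<ge> s0 \<Longrightarrow> e \<in> turning (Suc s) \<Longrightarrow> f \<in> parcs G \<Longrightarrow> nb_step e f \<Longrightarrow> f \<in> turning s"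
    using turning_stabilizes[OF assms] by blast
  have sub: "turning s \<subseteq> parcs G" for s
    by (auto simp: turning_def)
  \<comment> \<open>The reversal of a further arc \<open>h\<close> at the same vertex precedes both
    \<open>f\<close> and \<open>g\<close>: go up one level through \<open>f\<close> and come down
    through \<open>g\<close>.\<close>
  have tail: "g \<in> turning s"
    if s: "s \<ge> s0" and f: "f \<in> turning s" and g: "g \<in> parcs G" "fst g = fst f" for s f g
  proof -
    obtain h where h: "h \<in> parcs G" "fst h = fst f" "h \<noteq> f" "h \<noteq> g"
      using ex_arc_avoiding_two[OF assms arc_fst_in_verts, of f f g] f sub by blast
    have "nb_step (prod.swap h) f" "nb_step (prod.swap h) g"
      using h g by (auto simp: nb_step_def)
    then show ?thesis
      using succ[OF s predecessor_turning[OF f swap_in_parcs[OF h(1)]] g(1)] by blast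
  qed
  have up: "prod.swap f \<in> turning (Suc s)" if s: "s \<ge> s0" and f: "f \<in> turning s" for s f
  proof -
    obtain h where h: "h \<in> parcs G" "fst h = fst f" "h \<noteq> f"
      using ex_arc_avoiding_two[OF assms arc_fst_in_verts, of f f f] f sub by blast
    have "nb_step (prod.swap f) h"
      using h by (auto simp: nb_step_def)
    then show ?thesis
      using predecessor_turning[OF tail[OF s f h(1,2)] swap_in_parcs] f sub by blast
  qed
  \<comment> \<open>A successor \<open>h\<close> of \<open>f\<close> lies one level lower and shares
    its tail with the reversal of \<open>f\<close>.\<close>
  have down: "prod.swap f \<in> turning s" if s: "s \<ge> s0" and f: "f \<in> turning (Suc s)" for s f
  proof -
    have f_in: "f \<in> parcs G"
      using f sub by blast
    obtain h where h: "h \<in> parcs G" "fst h = snd f" "h \<noteq> prod.swap f"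
      using ex_arc_avoiding_two[OF assms arc_snd_in_verts[OF f_in], of "prod.swap f" "prod.swap f"]
      by blast
    then have "h \<in> turning s"
      using succ[OF s f h(1)] by (auto simp: nb_step_def)
    then show ?thesis
      using tail[OF s _ swap_in_parcs[OF f_in]] h by simp
  qed
  \<comment> \<open>Reversing twice restores the arc and shifts the level by two.\<close>
  have period: "turning (s + 2 * n) = turning s" if s: "s \<ge> s0" for s n
  proof (induction n)
    case (Suc n)
    have "turning (Suc (Suc t)) = turning t" if "t \<ge> s0" for t
    proof (intro equalityI subsetI)
      fix f assume "f \<in> turning t"
      then show "f \<in> turning (Suc (Suc t))"
        using up[of t f] up[of "Suc t" "prod.swap f"] that by simp
    next
      fix f assume "f \<in> turning (Suc (Suc t))"
      then show "f \<in> turning t"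
        using down[of "Suc t" f] down[of t "prod.swap f"] that by simp
    qed
    then show ?case
      using Suc s by simp
  qed simp
  \<comment> \<open>Branching leads to \<open>s + s + 2\<close>; an even \<open>s\<close> makes the
    difference from \<open>s\<close> even, so periodicity brings this back to
    \<open>s\<close>.\<close>
  define s where "s = 2 * s0"
  have s: "s \<ge> s0" "even s"
    by (auto simp: s_def)
  obtain f where f: "f \<in> turning s"
    using ne[OF s(1)] by blast
  have f_in: "f \<in> parcs G"
    using f sub by blast
  obtain g where g: "g \<in> parcs G" "fst g = fst f" "g \<noteq> f"
    using ex_arc_avoiding_two[OF assms arc_fst_in_verts[OF f_in], of f f] by blast
  obtain h where h: "h \<in> parcs G" "fst h = fst f" "h \<noteq> f" "h \<noteq> g"
    using ex_arc_avoiding_two[OF assms arc_fst_in_verts[OF f_in], of f g] by blast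
  define e where "e = prod.swap h"
  have e: "e \<in> parcs G" "nb_step e f" "nb_step e g"
    using swap_in_parcs[OF h(1)] h g by (auto simp: e_def nb_step_def)
  have "turnarounds G f s \<noteq> {}" "turnarounds G g s \<noteq> {}"
    using f tail[OF s(1) f g(1,2)] by (auto simp: turning_def)
  then have "turnarounds G e (s + s + 2) \<noteq> {}"
    using turnaround_branch[OF e(2,3) g(3)[symmetric] f_in g(1)] by fastforce
  then have "e \<in> turning (s + 2 * (Suc s0))"
    using e(1) by (simp add: turning_def s_def)
  then have "e \<in> turning s"
    using period[OF s(1)] by blast
  moreover have "e \<in> turning (Suc s)"
    by (rule predecessor_turning[OF f e(1,2)])
  ultimately have "turning s \<inter> turning (Suc s) \<noteq> {}"
    by blast
  \<comment> \<open>\<open>up\<close> and \<open>down\<close> exchange the two levels under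
    reversal, so their intersection is closed under reversal and, by \<open>tail\<close>, under
    change of arc at a vertex.\<close>
  then have "turning s \<inter> turning (Suc s) = parcs G"
  proof (intro eq_parcs_if_closed)
    show "turning s \<inter> turning (Suc s) \<subseteq> parcs G"
      using sub by blast
    show "prod.swap e \<in> turning s \<inter> turning (Suc s)" if "e \<in> turning s \<inter> turning (Suc s)" for e
      using that up down s(1) by blast
    show "f \<in> turning s \<inter> turning (Suc s)"
      if "e \<in> turning s \<inter> turning (Suc s)" "f \<in> parcs G" "fst f = fst e" for e f
      using that tail[of s e f] tail[of "Suc s" e f] s(1) by simp
  qed
  then show ?thesis
    using that[of s] sub by blast
qed

text \<open>Only the first turnaround varies; the second one stays fixed.\<close>

lemma Ev_ge_power:
  assumes "d \<ge> 3"
  obtains m where "\<And>j. (d - 1) ^ j \<le> Ev G (2 * (m + j))"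
proof -
  obtain m where m: "turning m = parcs G"
    using ex_all_turning[OF assms] by blast
  then have ne: "f \<in> parcs G \<Longrightarrow> turnarounds G f m \<noteq> {}" for f
    by (auto simp: turning_def)
  obtain e where e: "e \<in> parcs G"
    using parcs_nonempty assms by auto
  obtain w' where w': "w' \<in> turnarounds G (prod.swap e) m"
    using ne[OF swap_in_parcs[OF e]] by blast
  \<comment> \<open>The offset \<open>2 * m + 1\<close> consists of \<open>m\<close> for each
    turnaround and 1 for \<open>e\<close> with its reversal.\<close>
  have "(d - 1) ^ j \<le> Ev G (2 * (2 * m + 1 + j))" for j
  proof -
    have "(d - 1) ^ j \<le> card (turnarounds G e (m + j))"
      by (rule card_turnarounds_ge[OF ne e])
    also have "\<dots> \<le> card (even_walks G (2 * (m + j + m + 1)))"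
    proof (rule card_inj_on_le)
      show "inj_on (\<lambda>w. (e # w @ [prod.swap e]) @ w') (turnarounds G e (m + j))"
        by (auto simp: inj_on_def)
      show "(\<lambda>w. (e # w @ [prod.swap e]) @ w') ` turnarounds G e (m + j)
          \<subseteq> even_walks G (2 * (m + j + m + 1))"
        using even_walk_from_turnarounds[OF e _ w'] by blast
      show "finite (even_walks G (2 * (m + j + m + 1)))"
        by (rule finite_subset[OF _ finite_closed_nb_walks[OF pair_finite_arcs]])
          (auto simp: even_walks_def)
    qed
    also have "m + j + m + 1 = 2 * m + 1 + j"
      by simp
    finally show ?thesis
      unfolding Ev_def .
  qed
  then show ?thesis
    using that[of "2 * m + 1"] by blast
qed

lemma spectral_radius_nb_matrix:
  assumes "distinct es" "set es = parcs G" "d \<ge> 1"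
  shows "spectral_radius (map_mat complex_of_real (nb_matrix es (\<lambda>_. 1))) = real d - 1"
proof (rule spectral_radius_constant_row_sums[OF nb_matrix_carrier])
  have "es \<noteq> []"
    using parcs_nonempty[OF assms(3)] assms(2) by force
  then show "length es > 0"
    by simp
  show "0 \<le> nb_matrix es (\<lambda>_. 1) $$ (i, j)" if "i < length es" "j < length es" for i j
    unfolding nb_matrix_entry[OF that] by simp
  show "(\<Sum>j<length es. nb_matrix es (\<lambda>_. 1) $$ (i, j)) = real d - 1" if i: "i < length es" for i
  proof -
    have e: "es ! i \<in> parcs G"
      using nth_mem[OF i] assms(2) by simp
    have "(\<Sum>j<length es. nb_matrix es (\<lambda>_. 1) $$ (i, j)) =
        (\<Sum>j<length es. if nb_step (es ! i) (es ! j) then 1 else 0)"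
      by (rule sum.cong[OF refl], rule nb_matrix_entry[OF i]) simp
    also have "\<dots> = (\<Sum>f\<in>parcs G. if nb_step (es ! i) f then 1 else 0)"
      unfolding assms(2)[symmetric] by (rule sum_nth_distinct[OF assms(1)])
    also have "\<dots> = (\<Sum>f\<in>{f \<in> parcs G. nb_step (es ! i) f}. 1)"
      by (rule sum.inter_filter[OF pair_finite_arcs, symmetric])
    also have "\<dots> = real (d - 1)"
      by (simp only: sum_constant card_successors[OF e] mult_1_right)
    also have "\<dots> = real d - 1"
      using assms(3) by (simp add: of_nat_diff)
    finally show ?thesis .
  qed
qed

end

section \<open>From exponential growth to the limit inferior of roots\<close>

lemma Liminf_root_ge_sqrt:
  fixes E :: "nat \<Rightarrow> nat" and c :: real
  assumes c: "c \<ge> 1" and E: "\<And>j. c ^ j \<le> real (E (2 * (m + j)))"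
  shows "ereal (sqrt c) \<le>
    Liminf (inf sequentially (principal {l. even l})) (\<lambda>l. ereal (root l (real (E l))))"
proof -
  \<comment> \<open>For \<open>l = 2 * (m + j)\<close> the exponent is \<open>j / l\<close>, which
    tends to 1/2.\<close>
  define g where "g l = c powr (1 / 2 - real m / real l)" for l :: nat
  have "(\<lambda>l. 1 / 2 - real m / real l) \<longlonglongrightarrow> 1 / 2 - 0"
    by (intro tendsto_intros lim_const_over_n)
  then have "g \<longlonglongrightarrow> c powr (1 / 2)"
    unfolding g_def using c by (intro tendsto_powr tendsto_const) auto
  then have lim: "(\<lambda>l. ereal (g l)) \<longlonglongrightarrow> ereal (sqrt c)"
    using c by (simp add: powr_half_sqrt)
  have le: "g l \<le> root l (real (E l))" if l: "even l" "l > 2 * m" for l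
  proof -
    obtain k where k: "l = 2 * k"
      using l by blast
    define j where "j = k - m"
    have j: "l = 2 * (m + j)" "l > 0"
      using l k by (auto simp: j_def)
    have "1 / 2 - real m / real l = (real l - 2 * real m) / (2 * real l)"
      using j(2) by (simp add: field_simps)
    also have "real l - 2 * real m = 2 * real j"
      using j(1) by simp
    finally have "g l = (c powr real j) powr (1 / real l)"
      by (simp add: g_def powr_powr)
    also have "\<dots> = root l (c ^ j)"
      using c j by (simp add: root_powr_inverse powr_realpow inverse_eq_divide)
    also have "\<dots> \<le> root l (real (E l))"
      using E[of j] j by simp
    finally show ?thesis .
  qed
  show ?thesis
    unfolding le_Liminf_iff eventually_inf_principal
  proof (intro allI impI)
    fix y assume "y < ereal (sqrt c)"
    then have "eventually (\<lambda>l. y < ereal (g l)) sequentially"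
      by (rule order_tendstoD(1)[OF lim])
    then show "eventually (\<lambda>l. l \<in> {l. even l} \<longrightarrow> y < ereal (root l (real (E l)))) sequentially"
      using eventually_gt_at_top[of "2 * m"]
    proof eventually_elim
      case (elim l)
      show ?case
      proof
        assume "l \<in> {l. even l}"
        then have "ereal (g l) \<le> ereal (root l (real (E l)))"
          using le[of l] elim(2) by simp
        with elim(1) show "y < ereal (root l (real (E l)))"
          by (rule less_le_trans)
      qed
    qed
  qed
qed

text \<open>The last clause excludes \<open>d = 2\<close>: the graph is then a cycle with n edges,
  whose totally even closed walks have length divisible by 2n. So \<open>Ev\<close> vanishes at
  infinitely many even lengths and the limit inferior is 0, while \<open>\<rho>\<close> is
  1.\<close>

theorem proposition12:
  fixes G :: "'a pair_pre_digraph" and es :: "('a \<times> 'a) list" and d :: nat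
  assumes "pair_graph G"
    and "Digraph_Component.connected (with_proj G)"
    and "regular_graph G d"
    and "distinct es" and "set es = parcs G"
  defines "B \<equiv> nb_matrix es (\<lambda>_. 1)"
  defines "\<rho> \<equiv> spectral_radius (map_mat complex_of_real B)"
  shows "(\<forall>l>0. real (Ev G l) =
            (\<Sum>\<sigma>\<in>signings G. mat_trace (nb_matrix es \<sigma> ^\<^sub>m l)) / real (card (signings G))) \<and>
         (\<forall>l>0. even l \<longrightarrow>
            inj_on (\<lambda>w. w @ w) (closed_nb_walks G (l div 2)) \<and>
            (\<lambda>w. w @ w) ` closed_nb_walks G (l div 2) \<subseteq> even_walks G l \<and>
            real (Ev G l) \<ge> mat_trace (B ^\<^sub>m (l div 2))) \<and>
         (d \<ge> 1 \<longrightarrow> sqrt \<rho> = sqrt (real d - 1)) \<and>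
         (d \<ge> 1 \<and> d \<noteq> 2 \<longrightarrow>
            Liminf (inf sequentially (principal {l. even l})) (\<lambda>l. ereal (root l (real (Ev G l))))
              \<ge> ereal (sqrt \<rho>))"
proof -
  interpret pair_graph G
    by (fact assms(1))
  interpret regular_pair_graph G d
    by unfold_locales (fact assms(2), fact assms(3))
  have rho: "\<rho> = real d - 1" if "d \<ge> 1"
    unfolding \<rho>_def B_def by (rule spectral_radius_nb_matrix[OF assms(4,5) that])
  have doubling: "inj_on (\<lambda>w. w @ w) (closed_nb_walks G (l div 2)) \<and>
      (\<lambda>w. w @ w) ` closed_nb_walks G (l div 2) \<subseteq> even_walks G l \<and>
      mat_trace (B ^\<^sub>m (l div 2)) \<le> real (Ev G l)" if l: "l > 0" "even l" for l
  proof -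
    obtain k where k: "l = 2 * k" "k > 0"
      using l by (auto elim: evenE)
    have "inj_on (\<lambda>w. w @ w) (closed_nb_walks G k)"
      by (auto simp: inj_on_def closed_nb_walks_def)
    moreover have "(\<lambda>w. w @ w) ` closed_nb_walks G k \<subseteq> even_walks G l"
      using append_self_even_walk k by blast
    moreover have "mat_trace (B ^\<^sub>m k) = real (card (closed_nb_walks G k))"
      unfolding B_def trace_nb_matrix_pow[OF assms(4,5) k(2)] by (simp add: weight_def map_replicate_const)
    ultimately show ?thesis
      using card_closed_le_Ev[OF pair_finite_arcs k(2)] k by simp
  qed
  have "ereal (sqrt \<rho>) \<le>
      Liminf (inf sequentially (principal {l. even l})) (\<lambda>l. ereal (root l (real (Ev G l))))"
    if d: "d \<ge> 1" "d \<noteq> 2"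
  proof (cases "d = 1")
    case True
    show ?thesis
    proof (rule Liminf_bounded, rule always_eventually, rule allI)
      \<comment> \<open>Here \<open>\<rho>\<close> is 0. The case \<open>l = 0\<close> rests on the
        convention that \<open>root 0\<close> is 0.\<close>
      show "ereal (sqrt \<rho>) \<le> ereal (root l (real (Ev G l)))" for l
        using rho True by (cases "l = 0") simp_all
    qed
  next
    case False
    then have d3: "d \<ge> 3"
      using d by simp
    obtain m where m: "\<And>j. (d - 1) ^ j \<le> Ev G (2 * (m + j))"
      using Ev_ge_power[OF d3] by blast
    have "(real d - 1) ^ j \<le> real (Ev G (2 * (m + j)))" for j
    proof -
      have "real ((d - 1) ^ j) \<le> real (Ev G (2 * (m + j)))"
        by (rule of_nat_mono[OF m])
      then show ?thesis
        using d by (simp add: of_nat_diff)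
    qed
    then show ?thesis
      unfolding rho[OF d(1)] using d3 by (intro Liminf_root_ge_sqrt) auto
  qed
  then show ?thesis
    using Ev_eq_average[OF pair_finite_arcs assms(4,5)] doubling rho by blast
qed

end
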